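(* Let $\mathbf{K}\in\mathbb{R}^{n\times n}$ be symmetric positive semidefinite, $\mathbf{m}\in\mathbb{R}^n$, $\mathbf{H}\in\mathbb{R}^{p\times n}$, and let $\mathbf{R}\in\mathbb{R}^{p\times p}$ be symmetric positive definite. Let $\mathbf{f}\sim\mathcal{N}(\mathbf{m},\mathbf{K})$ and $\mathbf{y}=\mathbf{H}\mathbf{f}+\boldsymbol{\varepsilon}$, where $\boldsymbol{\varepsilon}\sim\mathcal{N}(\mathbf{0},\mathbf{R})$ is independent of $\mathbf{f}$. Define the finite-dimensional Hilbert space $$\mathcal{H}_{\mathbf{K}}:=\mathrm{Range}(\mathbf{K})\subseteq\mathbb{R}^n,\qquad \langle\mathbf{u},\mathbf{v}\rangle_{\mathcal{H}_{\mathbf{K}}}:=\mathbf{u}^\top\mathbf{K}^\dagger\mathbf{v}.$$ Let $\mathbf{x}_\star$ be the unique minimizer over $\mathbf{x}\in\mathrm{Range}(\mathbf{K})$ of $$\mathcal{J}(\mathbf{x})=\tfrac12\,\mathbf{x}^\top(\mathbf{K}^\dagger+\mathbf{H}^\top\mathbf{R}^{-1}\mathbf{H})\mathbf{x}-(\mathbf{H}^\top\mathbf{R}^{-1}\mathbf{d})^\top\mathbf{x}+\tfrac12\,\mathbf{d}^\top\mathbf{R}^{-1}\mathbf{d},\qquad \mathbf{d}:=\mathbf{y}-\mathbf{H}\mathbf{m},$$ and let $\mathbf{m}_{\mathrm{post}}=\mathbf{m}+\mathbf{x}_\star=\mathbb{E}[\mathbf{f}\mid\mathbf{y}]$ be the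 posterior mean. Then $$\mathbf{m}_{\mathrm{post}}=\operatorname*{arg\,min}_{\mathbf{g}\in\mathbf{m}+\mathcal{H}_{\mathbf{K}}}\ \|\mathbf{y}-\mathbf{H}\mathbf{g}\|_{\mathbf{R}^{-1}}^2+\|\mathbf{g}-\mathbf{m}\|_{\mathcal{H}_{\mathbf{K}}}^2 .$$ That is, the conditional Gaussian mean is the solution of RKHS-regularized regression with the RKHS norm induced by $\mathbf{K}$.
   Context: $\mathbf{K}^\dagger$ denotes the Moore–Penrose pseudoinverse. For a symmetric positive definite matrix $\mathbf{A}$, $\|\mathbf{v}\|_{\mathbf{A}}^2:=\mathbf{v}^\top\mathbf{A}\mathbf{v}$. The norm $\|\cdot\|_{\mathcal{H}_{\mathbf{K}}}$ is the one induced by $\langle\cdot,\cdot\rangle_{\mathcal{H}_{\mathbf{K}}}$, and $\mathbf{m}+\mathcal{H}_{\mathbf{K}}=\{\mathbf{m}+\mathbf{u}:\mathbf{u}\in\mathrm{Range}(\mathbf{K})\}$. The conditional mean $\mathbb{E}[\mathbf{f}\mid\mathbf{y}]$ is the mean of the Gaussian conditional distribution of $\mathbf{f}$ given $\mathbf{y}$ under the jointly Gaussian law of $(\mathbf{f},\mathbf{y})$. *)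

theory Defs
  imports "HOL-Probability.Probability"
begin

section \<open>Symmetric, positive (semi)definite matrices and weighted norms\<close>

definition symmetric_matrix :: "real^'n^'n \<Rightarrow> bool" where
  "symmetric_matrix A \<longleftrightarrow> transpose A = A"

definition sym_pos_semidef :: "real^'n^'n \<Rightarrow> bool" where
  "sym_pos_semidef A \<longleftrightarrow> symmetric_matrix A \<and> (\<forall>x. 0 \<le> x \<bullet> (A *v x))"

definition sym_pos_def :: "real^'n^'n \<Rightarrow> bool" where
  "sym_pos_def A \<longleftrightarrow> symmetric_matrix A \<and> (\<forall>x. x \<noteq> 0 \<longrightarrow> 0 < x \<bullet> (A *v x))"

definition weighted_norm :: "real^'n^'n \<Rightarrow> real^'n \<Rightarrow> real" where
  "weighted_norm A v = sqrt (v \<bullet> (A *v v))"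


section \<open>The Moore--Penrose pseudoinverse\<close>

definition is_pinv :: "real^'n^'m \<Rightarrow> real^'m^'n \<Rightarrow> bool" where
  "is_pinv A X \<longleftrightarrow>
     A ** X ** A = A \<and> X ** A ** X = X \<and>
     transpose (A ** X) = A ** X \<and> transpose (X ** A) = X ** A"

definition pinv :: "real^'n^'m \<Rightarrow> real^'m^'n" where
  "pinv A = (THE X. is_pinv A X)"

lemma is_pinv_unique:
  assumes X: "is_pinv A X" and Y: "is_pinv A Y"
  shows "X = Y"
proof -
  note x = X[unfolded is_pinv_def] and y = Y[unfolded is_pinv_def]
  have "A ** X = transpose (A ** X)" using x by simp
  also have "\<dots> = transpose ((A ** Y) ** (A ** X))"
    using y by (simp add: matrix_mul_assoc)
  also have "\<dots> = transpose (A ** X) ** transpose (A ** Y)" by (rule matrix_transpose_mul)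
  also have "\<dots> = (A ** X ** A) ** Y" using x y by (simp add: matrix_mul_assoc)
  finally have AX: "A ** X = A ** Y" using x by simp
  have "X ** A = transpose (X ** A)" using x by simp
  also have "\<dots> = transpose ((X ** A) ** (Y ** A))"
    using y by (metis matrix_mul_assoc)
  also have "\<dots> = transpose (Y ** A) ** transpose (X ** A)" by (rule matrix_transpose_mul)
  also have "\<dots> = Y ** (A ** X ** A)" using x y by (metis matrix_mul_assoc)
  finally have XA: "X ** A = Y ** A" using x by simp
  have "X = (X ** A) ** X" using x by simp
  also have "\<dots> = Y ** (A ** X)" by (simp add: XA matrix_mul_assoc)
  also have "\<dots> = Y" using y by (simp add: AX matrix_mul_assoc)
  finally show ?thesis .
qed

lemma orthogonal_projector_exists:
  fixes S :: "(real^'n) set"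
  assumes "subspace S"
  obtains P :: "real^'n^'n"
  where "transpose P = P" "\<And>x. P *v x \<in> S" "\<And>x. x \<in> S \<Longrightarrow> P *v x = x"
proof -
  obtain B where B: "B \<subseteq> S" "pairwise orthogonal B" "\<And>x. x \<in> B \<Longrightarrow> norm x = 1"
      "independent B" "span B = S"
    using orthonormal_basis_subspace[OF assms] by metis
  have fin: "finite B" using B(4) by (rule independent_imp_finite)
  define p where "p x = (\<Sum>b\<in>B. (x \<bullet> b) *\<^sub>R b)" for x
  have lin: "linear p"
    by (rule linearI)
       (simp_all add: p_def inner_add_left scaleR_add_left sum.distrib scaleR_sum_right)
  have pS: "p x \<in> S" for x
    unfolding p_def using B(1) assms by (intro subspace_sum subspace_scale) auto
  have pB: "p c = c" if "c \<in> B" for c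
  proof -
    have "p c = (\<Sum>b\<in>B. if b = c then c else 0)"
      unfolding p_def
    proof (rule sum.cong, simp)
      fix b assume "b \<in> B"
      then show "(c \<bullet> b) *\<^sub>R b = (if b = c then c else 0)"
        using B(2) B(3)[OF that] that
        by (auto simp: pairwise_def orthogonal_def dot_square_norm inner_commute)
    qed
    then show ?thesis using that fin by simp
  qed
  have pid: "p x = x" if "x \<in> S" for x
    using linear_eq_on_span[OF lin linear_id, of B x] pB that B(5) by auto
  have sym: "p x \<bullet> y = x \<bullet> p y" for x y
    by (simp add: p_def inner_sum_left inner_sum_right inner_commute mult.commute)
  have mv: "matrix p *v x = p x" for x using matrix_vector_mul(2)[OF lin] by metis
  have "transpose (matrix p) *v y = matrix p *v y" for y
    by (metis (no_types, lifting) dot_lmul_matrix mv sym transpose_matrix_vector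
        vector_eq_rdot)
  then have "transpose (matrix p) = matrix p" by (simp add: matrix_eq)
  then show thesis using that[of "matrix p"] mv pS pid by simp
qed

lemma is_pinv_exists: "\<exists>X. is_pinv (A :: real^'n^'m) X"
proof -
  have subV: "subspace (range ((*v) (transpose A)))" (is "subspace ?V")
    by (rule linear_subspace_image) (auto simp: subspace_UNIV)
  have subW: "subspace (range ((*v) A))" (is "subspace ?W")
    by (rule linear_subspace_image) (auto simp: subspace_UNIV)
  obtain P where P: "transpose P = P" "\<And>x. P *v x \<in> ?V" "\<And>x. x \<in> ?V \<Longrightarrow> P *v x = x"
    using orthogonal_projector_exists[OF subV] by blast
  obtain Q where Q: "transpose Q = Q" "\<And>x. Q *v x \<in> ?W" "\<And>x. x \<in> ?W \<Longrightarrow> Q *v x = x"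
    using orthogonal_projector_exists[OF subW] by blast
  have "P ** transpose A = transpose A"
    by (simp add: matrix_eq matrix_vector_mul_assoc[symmetric] P(3))
  then have "transpose (P ** transpose A) = A" by simp
  then have AP: "A ** P = A" by (simp add: matrix_transpose_mul P(1))
  have inj: "inj_on ((*v) A) ?V"
  proof (rule inj_onI)
    fix u v assume u: "u \<in> ?V" and v: "v \<in> ?V" and e: "A *v u = A *v v"
    have "u - v \<in> ?V" using subV u v by (rule subspace_diff)
    then obtain w where w: "u - v = transpose A *v w" by auto
    have "(u - v) \<bullet> (u - v) = w \<bullet> (A *v (u - v))"
      by (subst (1) w) (metis dot_lmul_matrix transpose_matrix_vector)
    also have "\<dots> = 0" using e by (simp add: matrix_vector_mult_diff_distrib)
    finally show "u = v" by simp
  qed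
  obtain g where g: "range g \<subseteq> ?V" "linear g" "\<And>v. v \<in> ?V \<Longrightarrow> g (A *v v) = v"
    using linear_exists_left_inverse_on[OF matrix_vector_mul_linear subV inj] by auto
  have mg: "matrix g *v x = g x" for x using matrix_vector_mul(2)[OF g(2)] by metis
  have gA: "g (A *v x) = P *v x" for x
    by (metis AP P(2) g(3) matrix_vector_mul_assoc)
  define X where "X = matrix g ** Q"
  have Xv: "X *v x = g (Q *v x)" for x by (simp add: X_def matrix_vector_mul_assoc[symmetric] mg)
  have XA: "X ** A = P"
    by (simp add: matrix_eq matrix_vector_mul_assoc[symmetric] Xv Q(3) gA)
  have Ag: "A *v g w = w" if "w \<in> ?W" for w
    using that by (auto simp: gA) (metis AP matrix_vector_mul_assoc)
  have AX: "A ** X = Q"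
    by (simp add: matrix_eq matrix_vector_mul_assoc[symmetric] Xv Ag Q(2))
  have "Q ** A = A" by (simp add: matrix_eq matrix_vector_mul_assoc[symmetric] Q(3))
  moreover have "P *v g w = g w" for w using g(1) P(3) by blast
  then have "P ** X = X" by (simp add: matrix_eq matrix_vector_mul_assoc[symmetric] Xv)
  ultimately have "is_pinv A X" by (simp add: is_pinv_def AX XA P(1) Q(1))
  then show ?thesis ..
qed

lemma is_pinv_pinv: "is_pinv A (pinv A)"
  unfolding pinv_def using is_pinv_exists[of A] is_pinv_unique by (metis theI)


section \<open>The Hilbert space attached to a covariance matrix\<close>

definition rkhs_space :: "real^'n^'n \<Rightarrow> (real^'n) set" where
  "rkhs_space K = range ((*v) K)"

definition rkhs_inner :: "real^'n^'n \<Rightarrow> real^'n \<Rightarrow> real^'n \<Rightarrow> real" where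
  "rkhs_inner K u v = u \<bullet> (pinv K *v v)"

definition rkhs_norm :: "real^'n^'n \<Rightarrow> real^'n \<Rightarrow> real" where
  "rkhs_norm K u = sqrt (rkhs_inner K u u)"

text \<open>Linearity in the first argument follows from symmetry; completeness is automatic, since
  the subspaces considered are finite-dimensional.\<close>

definition inner_product_on :: "(real^'n) set \<Rightarrow> (real^'n \<Rightarrow> real^'n \<Rightarrow> real) \<Rightarrow> bool" where
  "inner_product_on S ip \<longleftrightarrow>
     subspace S \<and>
     (\<forall>u\<in>S. \<forall>v\<in>S. ip u v = ip v u) \<and>
     (\<forall>u\<in>S. \<forall>v\<in>S. \<forall>w\<in>S. \<forall>a b. ip u (a *\<^sub>R v + b *\<^sub>R w) = a * ip u v + b * ip u w) \<and>
     (\<forall>u\<in>S. 0 \<le> ip u u \<and> (ip u u = 0 \<longleftrightarrow> u = 0))"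


section \<open>Multivariate normal laws, possibly degenerate\<close>

definition std_normal_vec :: "(real^'n) measure" where
  "std_normal_vec = density lborel (\<lambda>z. ennreal (\<Prod>i\<in>UNIV. std_normal_density (z $ i)))"

text \<open>\<open>is_normal m C N\<close> says that \<open>N\<close> is the law N(\<open>m\<close>, \<open>C\<close>), i.e. the law of \<open>m + L Z\<close> with
  \<open>Z\<close> standard normal and \<open>C = L L\<^sup>T\<close>.  The law does not depend on the choice of the factor \<open>L\<close>,
  and \<open>C\<close> may be singular.\<close>

definition is_normal :: "real^'n \<Rightarrow> real^'n^'n \<Rightarrow> (real^'n) measure \<Rightarrow> bool" where
  "is_normal m C N \<longleftrightarrow>
     (\<exists>L::real^'n^'n. L ** transpose L = C \<and> N = distr std_normal_vec borel (\<lambda>z. m + L *v z))"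


section \<open>Gaussian conditional distributions\<close>

text \<open>\<open>\<kappa>\<close> is a regular conditional distribution of \<open>X\<close> given \<open>Y\<close>: a Markov kernel that
  disintegrates the joint law of \<open>(X, Y)\<close> along the law of \<open>Y\<close>.\<close>

definition cond_distribution ::
    "'a measure \<Rightarrow> ('a \<Rightarrow> real^'n) \<Rightarrow> ('a \<Rightarrow> real^'p) \<Rightarrow> (real^'p \<Rightarrow> (real^'n) measure) \<Rightarrow> bool" where
  "cond_distribution M X Y \<kappa> \<longleftrightarrow>
     \<kappa> \<in> borel \<rightarrow>\<^sub>M prob_algebra borel \<and>
     (\<forall>A\<in>sets borel. \<forall>B\<in>sets borel.
        emeasure M {\<omega> \<in> space M. X \<omega> \<in> A \<and> Y \<omega> \<in> B} =
        (\<integral>\<^sup>+y\<in>B. emeasure (\<kappa> y) A \<partial>distr M borel Y))"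

text \<open>A conditional distribution is determined only up to null sets of values \<open>y\<close>.  For its mean to be
  defined at every single \<open>y\<close>, we take the version that is normal for every \<open>y\<close> and whose mean
  depends continuously on \<open>y\<close>, as is implicit in the usual Gaussian conditioning formula; it is
  unique as soon as the law of \<open>Y\<close> has full support.\<close>

definition is_gaussian_cond_mean ::
    "'a measure \<Rightarrow> ('a \<Rightarrow> real^'n) \<Rightarrow> ('a \<Rightarrow> real^'p) \<Rightarrow> (real^'p \<Rightarrow> real^'n) \<Rightarrow> bool" where
  "is_gaussian_cond_mean M X Y \<mu> \<longleftrightarrow>
     (\<exists>\<kappa>. cond_distribution M X Y \<kappa> \<and>
          (\<forall>y. \<exists>a C. is_normal a C (\<kappa> y)) \<and>
          (\<forall>y. integrable (\<kappa> y) (\<lambda>x. x) \<and> \<mu> y = (\<integral>x. x \<partial>\<kappa> y))) \<and>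
     continuous_on UNIV \<mu>"


section \<open>The two objective functions\<close>

definition post_objective ::
    "real^'n^'n \<Rightarrow> real^'n^'p \<Rightarrow> real^'p^'p \<Rightarrow> real^'p \<Rightarrow> real^'n \<Rightarrow> real" where
  "post_objective K H R d x =
     1/2 * (x \<bullet> ((pinv K + transpose H ** matrix_inv R ** H) *v x))
     - ((transpose H ** matrix_inv R) *v d) \<bullet> x
     + 1/2 * (d \<bullet> (matrix_inv R *v d))"

definition rkhs_regression_objective ::
    "real^'n^'n \<Rightarrow> real^'n \<Rightarrow> real^'n^'p \<Rightarrow> real^'p^'p \<Rightarrow> real^'p \<Rightarrow> real^'n \<Rightarrow> real" where
  "rkhs_regression_objective K m H R y g =
     (weighted_norm (matrix_inv R) (y - H *v g))\<^sup>2 + (rkhs_norm K (g - m))\<^sup>2"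

end

theory Submission
  imports Defs
begin

text \<open>Write \<open>f = m + L\<^sub>1 z\<^sub>1\<close> and \<open>\<epsilon> = L\<^sub>2 z\<^sub>2\<close> with independent standard normal \<open>z\<^sub>1, z\<^sub>2\<close>; \<open>L\<^sub>2\<close> is
  invertible, with inverse \<open>U\<close>. Taking \<open>y\<close> instead of \<open>z\<^sub>2\<close> as a variable and completing the square
  in \<open>z\<^sub>1\<close> turns the joint density of \<open>(z\<^sub>1, y)\<close> into a positive density of \<open>y\<close> times a nondegenerate
  Gaussian density of \<open>z\<^sub>1\<close> with mean \<open>G U d\<close>, where \<open>d = y - H m\<close>. This gives a Gaussian conditional
  law of \<open>f\<close> without any assumption on the rank of \<open>K\<close>, and positivity of the density of \<open>y\<close> makes
  its continuous mean \<open>m + L\<^sub>1 G U d\<close> unique. The normal equation of the completed square says that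
  \<open>x = L\<^sub>1 G U d\<close> satisfies \<open>x = K H\<^sup>T R\<^sup>-\<^sup>1 (d - H x)\<close>, which is the first-order condition on
  \<open>Range K\<close> of the strictly convex function \<open>\<parallel>d - H x\<parallel>\<^sup>2 + \<parallel>x\<parallel>\<^sup>2\<close> (in the norms of \<open>R\<^sup>-\<^sup>1\<close> and of the
  RKHS); both objectives are this function up to a factor and a translation.\<close>

section \<open>Linear substitutions in Lebesgue integrals\<close>

lemma nn_integral_lborel_affine:
  fixes g :: "'a::euclidean_space \<Rightarrow> ennreal"
  assumes [measurable]: "g \<in> borel_measurable borel" and "\<bar>c\<bar> = 1"
  shows "(\<integral>\<^sup>+x. g (t + c *\<^sub>R x) \<partial>lborel) = (\<integral>\<^sup>+x. g x \<partial>lborel)"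
proof -
  have "c \<noteq> 0" using assms(2) by auto
  then show ?thesis
    by (subst (2) lborel_affine[of c t]) (simp_all add: assms(2) density_1 nn_integral_distr)
qed

text \<open>Uniqueness of Haar measure: \<open>\<integral>\<integral> 1\<^sub>A(x) 1\<^sub>B(x + y) d\<lambda>(y) d\<nu>(x)\<close> equals both \<open>\<nu> A * \<lambda> B\<close> and
  \<open>\<nu> B * \<lambda> A\<close> for every translation invariant \<open>\<nu>\<close>, here the image of \<open>\<lambda>\<close> under \<open>T\<close>. The
  determinant formula of the library is not used, since it needs a wellordered index type.\<close>

lemma emeasure_lborel_vimage_linear_swap:
  fixes T :: "'a::euclidean_space \<Rightarrow> 'a"
  assumes "linear T" "bij T" and [measurable]: "A \<in> sets borel" "B \<in> sets borel"
  shows "emeasure lborel (T -` A) * emeasure lborel B = emeasure lborel (T -` B) * emeasure lborel A"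
proof -
  have [measurable]: "T \<in> borel_measurable borel"
    using assms(1) by (simp add: borel_measurable_continuous_onI linear_continuous_on linear_linear)
  have vim: "emeasure lborel (T -` S) = (\<integral>\<^sup>+x. indicator S (T x) \<partial>lborel)" if [measurable]: "S \<in> sets borel" for S
  proof -
    have "T -` S \<inter> space borel \<in> sets borel" by measurable
    then show ?thesis
      by (simp add: nn_integral_indicator[symmetric] indicator_def del: nn_integral_indicator)
  qed
  have "emeasure lborel (T -` A) * emeasure lborel B
      = (\<integral>\<^sup>+x. indicator A (T x) * (\<integral>\<^sup>+y. indicator B (T x + 1 *\<^sub>R y) \<partial>lborel) \<partial>lborel)"
    by (subst nn_integral_lborel_affine) (simp_all add: vim nn_integral_multc)
  also have "\<dots> = (\<integral>\<^sup>+x. \<integral>\<^sup>+y. indicator A (T x) * indicator B (T x + y) \<partial>lborel \<partial>lborel)"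
    by (simp add: nn_integral_cmult)
  also have "\<dots> = (\<integral>\<^sup>+y. \<integral>\<^sup>+x. indicator A (T x) * indicator B (T x + y) \<partial>lborel \<partial>lborel)"
    by (rule lborel_pair.Fubini') measurable
  also have "\<dots> = (\<integral>\<^sup>+y. \<integral>\<^sup>+x. indicator A (T x - y) * indicator B (T x) \<partial>lborel \<partial>lborel)"
  proof (rule nn_integral_cong)
    fix y :: 'a
    \<comment> \<open>Surjectivity writes the shift by \<open>y\<close> as \<open>T z\<close>, so
      moving \<open>x\<close> by \<open>- z\<close> carries it from the second indicator to the
      first.\<close>
    obtain z where z: "y = T z" using assms(2) by (metis bij_pointE)
    show "(\<integral>\<^sup>+x. indicator A (T x) * indicator B (T x + y) \<partial>lborel)
        = (\<integral>\<^sup>+x. indicator A (T x - y) * indicator B (T x) \<partial>lborel)"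
      by (subst nn_integral_lborel_affine[where c = 1 and t = "- z", symmetric])
         (simp_all add: z linear_diff[OF assms(1), symmetric] linear_add[OF assms(1), symmetric])
  qed
  also have "\<dots> = (\<integral>\<^sup>+x. \<integral>\<^sup>+y. indicator A (T x - y) * indicator B (T x) \<partial>lborel \<partial>lborel)"
    by (rule lborel_pair.Fubini') measurable
  also have "\<dots> = (\<integral>\<^sup>+x. (\<integral>\<^sup>+y. indicator A (T x + (- 1) *\<^sub>R y) \<partial>lborel) * indicator B (T x) \<partial>lborel)"
    by (simp add: nn_integral_multc)
  also have "\<dots> = emeasure lborel (T -` B) * emeasure lborel A"
    by (subst nn_integral_lborel_affine) (simp_all add: vim nn_integral_cmult mult.commute)
  finally show ?thesis .
qed

text \<open>Taking the unit box as \<open>B\<close> in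
  \<open>emeasure_lborel_vimage_linear_swap\<close> shows that the image of \<open>lborel\<close>
  under \<open>T\<close> is \<open>k\<close> times \<open>lborel\<close>. The constant
  \<open>c\<close> is \<open>1 / k\<close>, the absolute determinant of \<open>T\<close>; by
  translation invariance it serves every shift \<open>b\<close>.\<close>

lemma nn_integral_lborel_linear_bij:
  fixes T :: "'a::euclidean_space \<Rightarrow> 'a"
  assumes T: "linear T" "bij T"
  obtains c :: real where "0 < c"
    "\<And>b g. g \<in> borel_measurable borel \<Longrightarrow> (\<integral>\<^sup>+x. g x \<partial>lborel) = ennreal c * (\<integral>\<^sup>+x. g (b + T x) \<partial>lborel)"
proof -
  have [measurable]: "T \<in> borel_measurable borel"
    using assms(1) by (simp add: borel_measurable_continuous_onI linear_continuous_on linear_linear)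
  define Q :: "'a set" where "Q = box 0 One"
  have Q: "emeasure lborel Q = 1" "open Q" "bounded Q"
    by (simp_all add: Q_def emeasure_lborel_box_eq open_box)
  \<comment> \<open>Boundedness of the preimage of \<open>Q\<close> makes its volume
    \<open>k\<close> finite; being open and nonempty makes \<open>k\<close> nonzero.\<close>
  have TQ: "open (T -` Q)" "bounded (T -` Q)" "T -` Q \<noteq> {}"
  proof -
    show "open (T -` Q)"
      using Q(2) T(1) by (simp add: continuous_open_vimage linear_continuous_at linear_linear)
    have "T -` Q = inv T ` Q" using T(2) by (rule bij_vimage_eq_inv_image)
    moreover have "linear (inv T)" using T by (simp add: bij_def linear_injective_left_inverse inj_linear_imp_inv_linear)
    ultimately show "bounded (T -` Q)" using Q(3) by (simp add: bounded_linear_image linear_linear)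
    have "Q \<noteq> {}" using Q(1) by auto
    then show "T -` Q \<noteq> {}" using T(2) by (metis bij_is_surj surj_vimage_empty)
  qed
  define k where "k = emeasure lborel (T -` Q)"
  have "k < \<infinity>" using emeasure_bounded_finite[OF TQ(2)] by (simp add: k_def)
  moreover have "k \<noteq> 0"
  proof
    assume "k = 0"
    then have "T -` Q \<in> null_sets lborel" using TQ(1) by (simp add: k_def null_sets_def)
    then have "negligible (T -` Q)" by (simp add: negligible_iff_null_sets null_sets_completionI)
    then show False using TQ open_not_negligible by blast
  qed
  ultimately obtain r where r: "k = ennreal r" "0 < r"
    by (cases k) (auto simp: less_le)
  have "emeasure (distr lborel borel T) S = emeasure (scale_measure k lborel) S" if "S \<in> sets borel" for S
    using emeasure_lborel_vimage_linear_swap[OF T that, of Q] that Q(1,2)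
    by (simp add: emeasure_distr k_def)
  then have *: "distr lborel borel T = scale_measure k lborel"
    by (intro measure_eqI) simp_all
  show thesis
  proof
    show "0 < 1 / r" using r by simp
    fix b and g :: "'a \<Rightarrow> ennreal" assume [measurable]: "g \<in> borel_measurable borel"
    have "(\<integral>\<^sup>+x. g (b + T x) \<partial>lborel) = (\<integral>\<^sup>+x. g (b + x) \<partial>distr lborel borel T)"
      by (simp add: nn_integral_distr)
    also have "\<dots> = k * (\<integral>\<^sup>+x. g (b + 1 *\<^sub>R x) \<partial>lborel)"
      by (simp add: * nn_integral_scale_measure)
    also have "\<dots> = k * (\<integral>\<^sup>+x. g x \<partial>lborel)"
      by (subst nn_integral_lborel_affine) simp_all
    finally show "(\<integral>\<^sup>+x. g x \<partial>lborel) = ennreal (1 / r) * (\<integral>\<^sup>+x. g (b + T x) \<partial>lborel)"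
      using r by (simp add: mult.assoc[symmetric] ennreal_mult'[symmetric])
  qed
qed

section \<open>The standard normal law\<close>

text \<open>The standard normal density with its coordinate factors merged into one quadratic
  exponent, the form in which a square can be completed.\<close>

definition std_gauss :: "real^'n \<Rightarrow> real" where
  "std_gauss z = exp (- (z \<bullet> z) / 2) / sqrt (2 * pi) ^ CARD('n)"

lemma std_gauss_pos: "0 < std_gauss z"
  by (simp add: std_gauss_def)

lemma prod_std_normal_density:
  "(\<Prod>i\<in>UNIV. std_normal_density (z $ i)) = std_gauss (z :: real^'n)"
proof -
  have "(\<Prod>i\<in>UNIV. std_normal_density (z $ i)) = (\<Prod>i\<in>UNIV. exp (- (z $ i)\<^sup>2 / 2)) / sqrt (2 * pi) ^ CARD('n)"
    by (simp add: std_normal_density_def prod_dividef power_one_over)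
  also have "(\<Prod>i\<in>UNIV. exp (- (z $ i)\<^sup>2 / 2)) = exp (- (z \<bullet> z) / 2)"
    by (simp add: exp_sum[symmetric] inner_vec_def power2_eq_square sum_negf sum_divide_distrib)
  finally show ?thesis by (simp add: std_gauss_def)
qed

lemma std_gauss_measurable [measurable]: "std_gauss \<in> borel_measurable borel"
  unfolding std_gauss_def[abs_def] by measurable

lemma std_normal_vec_eq: "std_normal_vec = density lborel (\<lambda>z. ennreal (std_gauss z))"
  by (simp add: std_normal_vec_def prod_std_normal_density)

lemma sets_std_normal_vec [simp, measurable_cong]: "sets std_normal_vec = sets borel"
  by (simp add: std_normal_vec_eq)

lemma space_std_normal_vec [simp]: "space std_normal_vec = UNIV"
  by (simp add: std_normal_vec_eq)

lemma nn_integral_lborel_vec_prod: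
  fixes f :: "'n::finite \<Rightarrow> real \<Rightarrow> ennreal"
  assumes [measurable]: "\<And>i. f i \<in> borel_measurable borel"
  shows "(\<integral>\<^sup>+x. (\<Prod>i\<in>UNIV. f i ((x :: real^'n) $ i)) \<partial>lborel) = (\<Prod>i\<in>UNIV. \<integral>\<^sup>+x. f i x \<partial>lborel)"
proof -
  \<comment> \<open>On vectors, \<open>lborel\<close> is a product over \<open>Basis\<close>;
    \<open>j\<close> recovers the coordinate index from a basis vector.\<close>
  define j :: "real^'n \<Rightarrow> 'n" where "j b = (THE i. b = axis i 1)" for b
  have j: "j (axis i 1) = i" for i
    unfolding j_def by (rule the_equality) (auto simp: axis_eq_axis)
  have B: "(Basis :: (real^'n) set) = range (\<lambda>i. axis i 1)"
    by (auto simp: Basis_vec_def)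
  have inj: "inj (\<lambda>i::'n. axis i (1::real))"
    by (auto simp: inj_on_def axis_eq_axis)
  have "(\<integral>\<^sup>+x. (\<Prod>b\<in>Basis. f (j b) ((x :: real^'n) \<bullet> b)) \<partial>lborel) = (\<Prod>b\<in>(Basis :: (real^'n) set). \<integral>\<^sup>+x. f (j b) x \<partial>lborel)"
    by (rule nn_integral_lborel_prod) auto
  then show ?thesis
    by (simp add: B prod.reindex[OF inj] j inner_axis)
qed

lemma nn_integral_std_normal_density: "(\<integral>\<^sup>+x. ennreal (std_normal_density x) \<partial>lborel) = 1"
  using prob_space.emeasure_space_1[OF prob_space_normal_density[of 1 0]]
  by (simp add: emeasure_density)

lemma prob_space_std_normal_vec: "prob_space (std_normal_vec :: (real^'n) measure)"
proof
  have "(\<integral>\<^sup>+z. (\<Prod>i\<in>UNIV. ennreal (std_normal_density ((z :: real^'n) $ i))) \<partial>lborel) = 1"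
    by (subst nn_integral_lborel_vec_prod) (simp_all add: nn_integral_std_normal_density)
  then show "emeasure std_normal_vec (space (std_normal_vec :: (real^'n) measure)) = 1"
    by (simp add: std_normal_vec_def emeasure_density prod_ennreal)
qed

text \<open>The norm is at most the sum of the absolute coordinates. The integral of each of these
  factorizes into one absolute first moment and total masses equal to 1.\<close>

lemma integrable_std_normal_vec: "integrable std_normal_vec (\<lambda>z :: real^'n. z)"
proof (rule integrableI_bounded)
  show "(\<lambda>z::real^'n. z) \<in> borel_measurable std_normal_vec" by measurable
  have fin: "(\<integral>\<^sup>+z. ennreal \<bar>z $ k\<bar> \<partial>(std_normal_vec :: (real^'n) measure)) < \<infinity>" for k :: 'n
  proof -
    define f where "f i t = (if i = k then ennreal \<bar>t\<bar> else 1) * ennreal (std_normal_density t)" for i t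
    have [measurable]: "f i \<in> borel_measurable borel" for i unfolding f_def by measurable
    have "(\<integral>\<^sup>+z. ennreal \<bar>z $ k\<bar> \<partial>(std_normal_vec :: (real^'n) measure))
        = (\<integral>\<^sup>+z. (\<Prod>i\<in>UNIV. f i (z $ i)) \<partial>lborel)"
      unfolding f_def prod.distrib
      by (simp add: std_normal_vec_def nn_integral_density prod_ennreal mult.commute)
    also have "\<dots> = (\<Prod>i\<in>UNIV. \<integral>\<^sup>+t. f i t \<partial>lborel)"
      by (rule nn_integral_lborel_vec_prod) measurable
    also have "\<dots> < \<infinity>"
    proof -
      have "(\<integral>\<^sup>+t. f i t \<partial>lborel) < \<infinity>" for i
      proof (cases "i = k")
        case True
        have "integrable lborel (\<lambda>x. std_normal_density x * \<bar>x\<bar>)"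
          using integrable_std_normal_moment_abs[of 1] by simp
        then show ?thesis using True
          by (simp add: f_def integrable_iff_bounded abs_mult ennreal_mult'[symmetric] mult.commute)
      next
        case False
        then show ?thesis by (simp add: f_def nn_integral_std_normal_density)
      qed
      then show ?thesis by (simp add: less_top[symmetric] ennreal_prod_eq_top)
    qed
    finally show ?thesis .
  qed
  have "(\<integral>\<^sup>+z. ennreal (norm z) \<partial>(std_normal_vec :: (real^'n) measure))
      \<le> (\<integral>\<^sup>+z. (\<Sum>i\<in>UNIV. ennreal \<bar>z $ i\<bar>) \<partial>(std_normal_vec :: (real^'n) measure))"
    by (intro nn_integral_mono) (simp add: norm_le_l1_cart ennreal_leI)
  also have "\<dots> = (\<Sum>i\<in>UNIV. \<integral>\<^sup>+z. ennreal \<bar>z $ i\<bar> \<partial>(std_normal_vec :: (real^'n) measure))"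
    by (rule nn_integral_sum) measurable
  also have "\<dots> < \<infinity>" using fin by simp
  finally show "(\<integral>\<^sup>+z. ennreal (norm z) \<partial>(std_normal_vec :: (real^'n) measure)) < \<infinity>" .
qed

text \<open>The density is even and \<open>lborel\<close> is invariant under reflection, so the mean
  equals its own negative.\<close>

lemma integral_std_normal_vec: "(\<integral>z. z \<partial>std_normal_vec) = (0 :: real^'n)"
proof -
  have l: "distr lborel borel uminus = (lborel :: (real^'n) measure)"
    by (subst (2) lborel_affine[of "- 1" 0]) (simp_all add: density_1)
  have "(\<integral>z. z \<partial>(std_normal_vec :: (real^'n) measure)) = (\<integral>z. std_gauss z *\<^sub>R z \<partial>distr lborel borel uminus)"
    unfolding l by (simp add: std_normal_vec_eq integral_density std_gauss_pos less_imp_le)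
  also have "\<dots> = (\<integral>z. std_gauss z *\<^sub>R (- z) \<partial>lborel)"
    by (subst integral_distr) (simp_all add: std_gauss_def)
  also have "\<dots> = - (\<integral>z. z \<partial>(std_normal_vec :: (real^'n) measure))"
    by (simp add: std_normal_vec_eq integral_density std_gauss_pos less_imp_le)
  finally show ?thesis by (simp add: eq_neg_iff_add_eq_0 scaleR_2[symmetric])
qed

section \<open>Completing the square\<close>

lemma inner_transpose_mult: "(transpose A *v x) \<bullet> y = x \<bullet> (A *v (y :: real^_))"
  by (metis dot_lmul_matrix transpose_matrix_vector)

text \<open>Gram-Schmidt for the inner product \<open>x \<bullet> (P *v y)\<close>, by induction on
  the index set; the columns of \<open>V\<close> are the resulting orthonormal basis.\<close>

lemma sym_pos_def_orthonormal_basis: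
  fixes P :: "real^'n^'n"
  assumes "sym_pos_def P"
  obtains V :: "real^'n^'n" where "transpose V ** P ** V = mat 1"
proof -
  have sym: "x \<bullet> (P *v y) = y \<bullet> (P *v x)" for x y
    using assms inner_transpose_mult[of P x y]
    by (simp add: sym_pos_def_def symmetric_matrix_def inner_commute)
  have pos: "0 < x \<bullet> (P *v x)" if "x \<noteq> 0" for x
    using assms that by (simp add: sym_pos_def_def)
  have "\<exists>v :: 'n \<Rightarrow> real^'n. \<forall>i\<in>I. \<forall>j\<in>I. v i \<bullet> (P *v v j) = (if i = j then 1 else 0)"
    if "finite I" for I :: "'n set"
    using that
  proof (induction I)
    case empty
    then show ?case by simp
  next
    case (insert k I)
    then obtain v :: "'n \<Rightarrow> real^'n"
      where v: "\<And>i j. i \<in> I \<Longrightarrow> j \<in> I \<Longrightarrow> v i \<bullet> (P *v v j) = (if i = j then 1 else 0)"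
      by blast
    \<comment> \<open>Since \<open>k\<close> lies outside \<open>I\<close>, there are fewer than
      \<open>CARD('n)\<close> vectors \<open>P *v v j\<close>. A nonzero \<open>x\<close> orthogonal
      to all of them is \<open>P\<close>-orthogonal to every \<open>v j\<close> and only needs
      rescaling.\<close>
    have "dim ((\<lambda>j. P *v v j) ` I) \<le> card I"
      using insert.hyps(1) by (meson card_image_le dim_le_card' finite_imageI le_trans)
    also have "\<dots> < CARD('n)"
      using insert.hyps by (metis UNIV_I finite psubset_card_mono psubsetI subset_UNIV)
    finally have "dim ((\<lambda>j. P *v v j) ` I) < DIM(real^'n)" by simp
    then obtain x where x: "x \<noteq> 0" "\<And>y. y \<in> span ((\<lambda>j. P *v v j) ` I) \<Longrightarrow> orthogonal x y"
      using orthogonal_to_subspace_exists by blast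
    define w where "w = (1 / sqrt (x \<bullet> (P *v x))) *\<^sub>R x"
    have ww: "w \<bullet> (P *v w) = 1"
      using pos[OF x(1)] by (simp add: w_def matrix_vector_mult_scaleR field_simps)
    have wv: "w \<bullet> (P *v v j) = 0" if "j \<in> I" for j
      using x(2)[of "P *v v j"] that by (simp add: w_def span_base orthogonal_def)
    have "\<forall>i\<in>insert k I. \<forall>j\<in>insert k I. (v(k := w)) i \<bullet> (P *v (v(k := w)) j) = (if i = j then 1 else 0)"
    proof (intro ballI)
      fix i j assume "i \<in> insert k I" "j \<in> insert k I"
      moreover have "v i \<bullet> (P *v w) = 0" if "i \<in> I" for i
        using wv[OF that] sym[of "v i" w] by simp
      ultimately show "(v(k := w)) i \<bullet> (P *v (v(k := w)) j) = (if i = j then 1 else 0)"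
        using ww wv v insert.hyps(2) by (cases "i = k"; cases "j = k") auto
    qed
    then show ?case by blast
  qed
  from this[of UNIV] obtain v :: "'n \<Rightarrow> real^'n"
    where v: "\<And>i j. v i \<bullet> (P *v v j) = (if i = j then 1 else 0)" by auto
  define V where "V = transpose (\<chi> i. v i)"
  have col: "V *v axis j 1 = v j" for j
    by (simp add: V_def matrix_vector_mult_basis column_def transpose_def vec_eq_iff)
  have "(transpose V ** P ** V) $ i $ j = mat 1 $ i $ j" for i j
  proof -
    have "(transpose V ** P ** V) $ i $ j = ((transpose V ** P ** V) *v axis j 1) \<bullet> axis i 1"
      by (simp add: matrix_vector_mult_basis column_def inner_axis)
    also have "\<dots> = (P *v v j) \<bullet> v i"
      by (simp add: matrix_vector_mul_assoc[symmetric] col inner_transpose_mult del: transpose_matrix_vector)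
    also have "\<dots> = mat 1 $ i $ j"
      using v[of i j] by (simp add: mat_def inner_commute)
    finally show ?thesis .
  qed
  then have "transpose V ** P ** V = mat 1" by (simp add: vec_eq_iff)
  then show thesis by (rule that)
qed

text \<open>Completing the square: with \<open>P = 1 + A\<^sup>T A\<close> and \<open>V\<^sup>T P V = 1\<close>, the matrix \<open>G = V V\<^sup>T A\<^sup>T\<close>
  is \<open>P\<^sup>-\<^sup>1 A\<^sup>T\<close>, so \<open>G *v e\<close> minimizes \<open>z \<bullet> z + (e - A z) \<bullet> (e - A z)\<close>.\<close>

lemma complete_square_obtain:
  fixes A :: "real^'n^'p"
  obtains V :: "real^'n^'n" and G :: "real^'p^'n"
  where "invertible V"
    "\<And>e. G *v e = transpose A *v (e - A *v (G *v e))"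
    "\<And>e w z. z = G *v e + V *v w \<Longrightarrow>
       z \<bullet> z + (e - A *v z) \<bullet> (e - A *v z) = w \<bullet> w + (e \<bullet> e - (A *v (G *v e)) \<bullet> e)"
proof -
  define P where "P = mat 1 + transpose A ** A"
  have Pv: "P *v x = x + transpose A *v (A *v x)" for x
    by (simp add: P_def matrix_vector_mult_add_rdistrib matrix_vector_mul_assoc)
  have xPy: "x \<bullet> (P *v y) = x \<bullet> y + (A *v x) \<bullet> (A *v y)" for x y
    using inner_transpose_mult[of A "A *v y" x] by (simp add: Pv inner_add_right inner_commute)
  have "sym_pos_def P"
    unfolding sym_pos_def_def symmetric_matrix_def
  proof (intro conjI allI impI)
    show "transpose P = P"
      by (simp add: P_def vec_eq_iff transpose_def matrix_matrix_mult_def mat_def mult.commute)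
    fix x :: "real^'n" assume "x \<noteq> 0"
    then show "0 < x \<bullet> (P *v x)" by (simp add: xPy add_pos_nonneg)
  qed
  then obtain V :: "real^'n^'n" where V: "transpose V ** P ** V = mat 1"
    using sym_pos_def_orthonormal_basis by blast
  \<comment> \<open>A one-sided inverse of a square matrix is two-sided, so
    \<open>V ** transpose V\<close> is the inverse of \<open>P\<close>.\<close>
  then have VV: "V ** (transpose V ** P) = mat 1" by (metis matrix_left_right_inverse)
  have inv: "invertible V" using V invertible_left_inverse by blast
  have VVP: "P ** (V ** transpose V) = mat 1"
    using VV by (metis matrix_left_right_inverse matrix_mul_assoc)
  define G where "G = V ** transpose V ** transpose A"
  have PG: "P *v (G *v e) = transpose A *v e" for e
    by (simp add: G_def matrix_vector_mul_assoc matrix_mul_assoc)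
       (simp add: VVP[unfolded matrix_mul_assoc] )
  have g: "G *v e = transpose A *v (e - A *v (G *v e))" for e
    using PG[of e] by (simp add: Pv matrix_vector_mult_diff_distrib algebra_simps)
  have "z \<bullet> z + (e - A *v z) \<bullet> (e - A *v z) = w \<bullet> w + (e \<bullet> e - (A *v (G *v e)) \<bullet> e)"
    if z: "z = G *v e + V *v w" for e w z
  proof -
    have "transpose V *v (P *v (V *v w)) = w"
      by (simp add: matrix_vector_mul_assoc matrix_mul_assoc V)
    then have 1: "(V *v w) \<bullet> (P *v (V *v w)) = w \<bullet> w"
      using inner_transpose_mult[of V "P *v (V *v w)" w] by (simp add: inner_commute)
    \<comment> \<open>After expansion at \<open>G *v e + V *v w\<close>, this cancels the cross
      terms linear in \<open>w\<close> and reduces the part without \<open>w\<close> to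
      \<open>e \<bullet> e - (A *v (G *v e)) \<bullet> e\<close>.\<close>
    have 2: "x \<bullet> (P *v (G *v e)) = (A *v x) \<bullet> e" for x
      using inner_transpose_mult[of A e x] by (simp add: PG inner_commute)
    show ?thesis
      using 1 2[of "V *v w"] 2[of "G *v e"]
      unfolding xPy z
      by (simp add: matrix_vector_right_distrib inner_add_left inner_add_right inner_diff_left
          inner_diff_right inner_commute algebra_simps)
  qed
  then show thesis using inv g that by blast
qed

text \<open>Of the normalizing factors of both densities, \<open>std_gauss w\<close> absorbs those
  of \<open>z\<close>; the others stay with the exponential of \<open>s\<close>, in a factor free of
  \<open>w\<close>.\<close>

lemma std_gauss_mult_affine:
  fixes A :: "real^'n^'p" and w :: "real^'n"
  assumes "z \<bullet> z + (e - A *v z) \<bullet> (e - A *v z) = w \<bullet> w + s"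
  shows "std_gauss z * std_gauss (e - A *v z) = std_gauss w * (exp (- s / 2) / sqrt (2 * pi) ^ CARD('p))"
proof -
  have "exp (- (z \<bullet> z) / 2) * exp (- ((e - A *v z) \<bullet> (e - A *v z)) / 2) = exp (- (w \<bullet> w) / 2) * exp (- s / 2)"
    using assms by (simp add: exp_add[symmetric] field_simps)
  then show ?thesis by (simp add: std_gauss_def)
qed

section \<open>Conditional distributions\<close>

lemma matrix_mult_measurable [measurable (raw)]:
  fixes A :: "real^'n^'m"
  assumes "f \<in> borel_measurable M"
  shows "(\<lambda>x. A *v f x) \<in> borel_measurable M"
  by (rule borel_measurable_continuous_on[OF _ assms]) (intro continuous_intros)

lemma bij_matrix_vector_mult: "invertible (A :: real^'n^'n) \<Longrightarrow> bij ((*v) A)"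
  using invertible_eq_bij by blast

text \<open>Disintegration along \<open>c + B z\<^sub>1 + L\<^sub>2 z\<^sub>2\<close>: substitute it for \<open>z\<^sub>2\<close>, then complete the square in \<open>z\<^sub>1\<close>.\<close>

lemma gaussian_disintegration:
  fixes L1 :: "real^'n^'n" and L2 U :: "real^'p^'p" and B :: "real^'n^'p"
    and m :: "real^'n" and c :: "real^'p"
  assumes U: "L2 ** U = mat 1"
  obtains k :: "real^'p \<Rightarrow> real" and V :: "real^'n^'n" and G :: "real^'p^'n"
  where "k \<in> borel_measurable borel" "\<And>y. 0 < k y"
    "\<And>e. G *v e = transpose (U ** B) *v (e - (U ** B) *v (G *v e))"
    "\<And>S T. S \<in> sets borel \<Longrightarrow> T \<in> sets borel \<Longrightarrow>
      (\<integral>\<^sup>+z1. \<integral>\<^sup>+z2. indicator S (m + L1 *v z1) * indicator T (c + B *v z1 + L2 *v z2) \<partial>std_normal_vec \<partial>std_normal_vec)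
      = (\<integral>\<^sup>+y. ennreal (k y) * (emeasure (distr std_normal_vec borel (\<lambda>w. m + L1 *v (G *v (U *v (y - c))) + (L1 ** V) *v w)) S
            * indicator T y) \<partial>lborel)"
proof -
  obtain V :: "real^'n^'n" and G :: "real^'p^'n"
    where V: "invertible V"
      and G: "\<And>e. G *v e = transpose (U ** B) *v (e - (U ** B) *v (G *v e))"
      and sq: "\<And>e w z. z = G *v e + V *v w \<Longrightarrow>
       z \<bullet> z + (e - (U ** B) *v z) \<bullet> (e - (U ** B) *v z) = w \<bullet> w + (e \<bullet> e - ((U ** B) *v (G *v e)) \<bullet> e)"
    using complete_square_obtain[of "U ** B"] by blast
  have LU: "L2 *v (U *v x) = x" for x by (simp add: matrix_vector_mul_assoc U)
  have invU: "invertible U" using U invertible_left_inverse by blast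
  \<comment> \<open>\<open>b\<close> and \<open>a\<close> are the Jacobian constants of the two
    substitutions, through \<open>U\<close> for the second variable and through \<open>V\<close> for
    the first.\<close>
  obtain b where b: "0 < b" "\<And>t g. g \<in> borel_measurable borel \<Longrightarrow>
      (\<integral>\<^sup>+x. g x \<partial>lborel) = ennreal b * (\<integral>\<^sup>+x. g (t + U *v x) \<partial>lborel)"
    using nn_integral_lborel_linear_bij[OF matrix_vector_mul_linear bij_matrix_vector_mult[OF invU]] by blast
  obtain a where a: "0 < a" "\<And>t g. g \<in> borel_measurable borel \<Longrightarrow>
      (\<integral>\<^sup>+x. g x \<partial>lborel) = ennreal a * (\<integral>\<^sup>+x. g (t + V *v x) \<partial>lborel)"
    using nn_integral_lborel_linear_bij[OF matrix_vector_mul_linear bij_matrix_vector_mult[OF V]] by blast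
  \<comment> \<open>\<open>h\<close> carries the constant term of the completed square; with both
    Jacobians, \<open>k\<close> is the density of \<open>c + B *v z1 + L2 *v z2\<close>.\<close>
  define h where "h e = exp (- (e \<bullet> e - ((U ** B) *v (G *v e)) \<bullet> e) / 2) / sqrt (2 * pi) ^ CARD('p)" for e
  define k where "k y = b * a * h (U *v (y - c))" for y
  have hpos: "0 < h e" for e by (simp add: h_def)
  have [measurable]: "h \<in> borel_measurable borel" unfolding h_def[abs_def] by measurable
  show thesis
  proof (rule that[of k G V, OF _ _ G])
    show "k \<in> borel_measurable borel" unfolding k_def[abs_def] by measurable
    show "0 < k y" for y using a(1) b(1) hpos by (simp add: k_def)
    fix S :: "(real^'n) set" and T :: "(real^'p) set"
    assume [measurable]: "S \<in> sets borel" "T \<in> sets borel"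
    have "(\<integral>\<^sup>+z1. \<integral>\<^sup>+z2. indicator S (m + L1 *v z1) * indicator T (c + B *v z1 + L2 *v z2) \<partial>std_normal_vec \<partial>std_normal_vec)
      = (\<integral>\<^sup>+z1. ennreal (std_gauss z1) * (\<integral>\<^sup>+z2. ennreal (std_gauss z2) *
          (indicator S (m + L1 *v z1) * indicator T (c + B *v z1 + L2 *v z2)) \<partial>lborel) \<partial>lborel)"
      by (simp add: std_normal_vec_eq nn_integral_density)
    also have "\<dots> = (\<integral>\<^sup>+z1. \<integral>\<^sup>+y. ennreal b * (ennreal (std_gauss z1) * (ennreal (std_gauss (U *v (y - c) - (U ** B) *v z1)) *
          (indicator S (m + L1 *v z1) * indicator T y))) \<partial>lborel \<partial>lborel)"
    proof (rule nn_integral_cong)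
      fix z1 :: "real^'n"
      \<comment> \<open>The substitution is \<open>z2 = U *v (y - c - B *v z1)\<close>, written as a
        shift plus \<open>U *v y\<close>: \<open>e\<close> shows that it restores \<open>y\<close>,
        and \<open>e'\<close> that it is the residual in the square to be completed.\<close>
      have e: "c + B *v z1 + L2 *v (- (U *v (c + B *v z1)) + U *v y) = y" for y
        by (simp add: matrix_vector_right_distrib matrix_vector_mult_diff_distrib LU
            linear_neg[OF matrix_vector_mul_linear])
      have e': "- (U *v (c + B *v z1)) + U *v y = U *v (y - c) - (U ** B) *v z1" for y
        by (simp add: matrix_vector_right_distrib matrix_vector_mult_diff_distrib matrix_vector_mul_assoc)
      show "ennreal (std_gauss z1) * (\<integral>\<^sup>+z2. ennreal (std_gauss z2) *
          (indicator S (m + L1 *v z1) * indicator T (c + B *v z1 + L2 *v z2)) \<partial>lborel)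
        = (\<integral>\<^sup>+y. ennreal b * (ennreal (std_gauss z1) * (ennreal (std_gauss (U *v (y - c) - (U ** B) *v z1)) *
          (indicator S (m + L1 *v z1) * indicator T y))) \<partial>lborel)"
      proof -
        have "(\<integral>\<^sup>+z2. ennreal (std_gauss z2) * (indicator S (m + L1 *v z1) * indicator T (c + B *v z1 + L2 *v z2)) \<partial>lborel)
          = ennreal b * (\<integral>\<^sup>+y. ennreal (std_gauss (U *v (y - c) - (U ** B) *v z1)) * (indicator S (m + L1 *v z1) * indicator T y) \<partial>lborel)"
          by (subst b(2)[where t = "- (U *v (c + B *v z1))"], measurable) (simp only: e'[symmetric] e)
        then show ?thesis
          by (simp add: nn_integral_cmult mult.left_commute)
      qed
    qed
    also have "\<dots> = (\<integral>\<^sup>+y. \<integral>\<^sup>+z1. ennreal b * (ennreal (std_gauss z1) * (ennreal (std_gauss (U *v (y - c) - (U ** B) *v z1)) *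
          (indicator S (m + L1 *v z1) * indicator T y))) \<partial>lborel \<partial>lborel)"
      by (rule lborel_pair.Fubini') measurable
    also have "\<dots> = (\<integral>\<^sup>+y. ennreal (k y) * (emeasure (distr std_normal_vec borel (\<lambda>w. m + L1 *v (G *v (U *v (y - c))) + (L1 ** V) *v w)) S
            * indicator T y) \<partial>lborel)"
    proof (rule nn_integral_cong)
      fix y :: "real^'p"
      define e where "e = U *v (y - c)"
      have L: "m + L1 *v (G *v e) + (L1 ** V) *v w = m + L1 *v (G *v e + V *v w)" for w
        by (simp add: matrix_vector_right_distrib matrix_vector_mul_assoc)
      have "emeasure (distr std_normal_vec borel (\<lambda>w. m + L1 *v (G *v e) + (L1 ** V) *v w)) S
          = (\<integral>\<^sup>+x. indicator S x \<partial>distr std_normal_vec borel (\<lambda>w. m + L1 *v (G *v e) + (L1 ** V) *v w))"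
        by simp
      also have "\<dots> = (\<integral>\<^sup>+w. ennreal (std_gauss w) * indicator S (m + L1 *v (G *v e + V *v w)) \<partial>lborel)"
        by (subst nn_integral_distr) (simp_all add: std_normal_vec_eq nn_integral_density L)
      finally have em: "emeasure (distr std_normal_vec borel (\<lambda>w. m + L1 *v (G *v e) + (L1 ** V) *v w)) S
          = (\<integral>\<^sup>+w. ennreal (std_gauss w) * indicator S (m + L1 *v (G *v e + V *v w)) \<partial>lborel)" .
      have "(\<integral>\<^sup>+z1. ennreal b * (ennreal (std_gauss z1) * (ennreal (std_gauss (e - (U ** B) *v z1)) *
          (indicator S (m + L1 *v z1) * indicator T y))) \<partial>lborel)
        = ennreal b * indicator T y * (\<integral>\<^sup>+z1. ennreal (std_gauss z1 * std_gauss (e - (U ** B) *v z1)) *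
          indicator S (m + L1 *v z1) \<partial>lborel)"
        by (simp add: nn_integral_cmult[symmetric] ennreal_mult std_gauss_pos less_imp_le ac_simps)
      \<comment> \<open>Here \<open>z1 = G *v e + V *v w\<close>, which separates the weight
        \<open>h e\<close> from a standard normal \<open>w\<close>.\<close>
      also have "(\<integral>\<^sup>+z1. ennreal (std_gauss z1 * std_gauss (e - (U ** B) *v z1)) * indicator S (m + L1 *v z1) \<partial>lborel)
        = ennreal a * (\<integral>\<^sup>+w. ennreal (std_gauss w * h e) * indicator S (m + L1 *v (G *v e + V *v w)) \<partial>lborel)"
        by (subst a(2)[where t = "G *v e"], measurable) (simp only: std_gauss_mult_affine[OF sq[OF refl]] h_def)
      also have "\<dots> = ennreal a * (ennreal (h e) * (\<integral>\<^sup>+w. ennreal (std_gauss w) * indicator S (m + L1 *v (G *v e + V *v w)) \<partial>lborel))"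
        by (simp add: nn_integral_cmult[symmetric] ennreal_mult std_gauss_pos hpos less_imp_le ac_simps)
      finally show "(\<integral>\<^sup>+z1. ennreal b * (ennreal (std_gauss z1) * (ennreal (std_gauss (U *v (y - c) - (U ** B) *v z1)) *
          (indicator S (m + L1 *v z1) * indicator T y))) \<partial>lborel)
        = ennreal (k y) * (emeasure (distr std_normal_vec borel (\<lambda>w. m + L1 *v (G *v (U *v (y - c))) + (L1 ** V) *v w)) S * indicator T y)"
        unfolding k_def e_def[symmetric] em
        using a(1) b(1) hpos[of e] by (simp add: ennreal_mult less_imp_le ac_simps)
    qed
    finally show "(\<integral>\<^sup>+z1. \<integral>\<^sup>+z2. indicator S (m + L1 *v z1) * indicator T (c + B *v z1 + L2 *v z2) \<partial>std_normal_vec \<partial>std_normal_vec)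
      = (\<integral>\<^sup>+y. ennreal (k y) * (emeasure (distr std_normal_vec borel (\<lambda>w. m + L1 *v (G *v (U *v (y - c))) + (L1 ** V) *v w)) S
            * indicator T y) \<partial>lborel)" .
  qed
qed

section \<open>Uniqueness of conditional laws and of their continuous mean\<close>

text \<open>For a fixed event both kernels have the same integrals over all sets, hence agree almost
  everywhere. A countable generator stable under intersections allows one null set for all its
  members, and agreement on it determines the measures.\<close>

lemma cond_distribution_AE_unique:
  fixes X :: "'a \<Rightarrow> real^'n" and Y :: "'a \<Rightarrow> real^'p"
  assumes "prob_space M" and [measurable]: "Y \<in> borel_measurable M"
    and "cond_distribution M X Y \<kappa>" "cond_distribution M X Y \<kappa>'"
  shows "AE y in distr M borel Y. \<kappa> y = \<kappa>' y"
proof -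
  interpret M: prob_space M by fact
  interpret D: prob_space "distr M borel Y" by (rule M.prob_space_distr) measurable
  obtain B0 :: "(real^'n) set set" where B0: "countable B0" "topological_basis B0"
    using ex_countable_basis by blast
  \<comment> \<open>Finite intersections of members of a countable basis are still countably many;
    the empty family contributes \<open>UNIV\<close>, which also serves as the cover of finite
    measure below.\<close>
  define E where "E = Inter ` {F. F \<subseteq> B0 \<and> finite F}"
  have E_open: "open b" if "b \<in> E" for b
    using that topological_basis_open[OF B0(2)] by (auto simp: E_def)
  have "B0 \<subseteq> E" by (auto simp: E_def intro!: image_eqI[of _ _ "{_}"])
  then have basis: "topological_basis E"
    using B0(2) E_open unfolding topological_basis_def by (meson subset_trans)
  have count: "countable E"
    unfolding E_def using countable_Collect_finite_subset[OF B0(1)] by (simp add: conj_commute)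
  have stable: "Int_stable E"
  proof (rule Int_stableI)
    fix a b assume "a \<in> E" "b \<in> E"
    then obtain F F' where "a = \<Inter>F" "b = \<Inter>F'" "F \<subseteq> B0" "F' \<subseteq> B0" "finite F" "finite F'"
      by (auto simp: E_def)
    then show "a \<inter> b \<in> E" by (auto simp: E_def intro!: image_eqI[of _ _ "F \<union> F'"])
  qed
  have UNIV: "UNIV \<in> E" by (auto simp: E_def intro!: image_eqI[of _ _ "{}"])
  have sets: "sets borel = sigma_sets UNIV E"
    by (subst borel_eq_countable_basis[OF count basis]) simp
  note \<kappa> = assms(3,4)[unfolded cond_distribution_def]
  have [measurable]: "\<kappa> \<in> borel \<rightarrow>\<^sub>M subprob_algebra borel" "\<kappa>' \<in> borel \<rightarrow>\<^sub>M subprob_algebra borel"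
    using \<kappa> by (auto intro: measurable_prob_algebraD)
  have sp: "sets (\<kappa> y) = sets borel" "sets (\<kappa>' y) = sets borel" "emeasure (\<kappa> y) UNIV = 1" for y
  proof -
    have "\<kappa> y \<in> space (prob_algebra borel)" "\<kappa>' y \<in> space (prob_algebra borel)"
      using \<kappa> by (auto elim: measurable_space)
    then show s: "sets (\<kappa> y) = sets borel" "sets (\<kappa>' y) = sets borel"
      and "emeasure (\<kappa> y) UNIV = 1"
      using prob_space.emeasure_space_1[of "\<kappa> y"] sets_eq_imp_space_eq[of "\<kappa> y" borel]
      by (simp_all add: space_prob_algebra)
  qed
  have "AE y in distr M borel Y. \<forall>A\<in>E. emeasure (\<kappa> y) A = emeasure (\<kappa>' y) A"
  proof (subst AE_ball_countable[OF count], intro ballI)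
    fix A assume "A \<in> E"
    then have [measurable]: "A \<in> sets borel" using E_open by auto
    show "AE y in distr M borel Y. emeasure (\<kappa> y) A = emeasure (\<kappa>' y) A"
    proof (rule D.density_unique2)
      fix S assume "S \<in> sets (distr M borel Y)"
      then have S: "S \<in> sets borel" by simp
      note \<kappa>(1)[THEN conjunct2, rule_format, OF \<open>A \<in> sets borel\<close> S, symmetric]
      also note \<kappa>(2)[THEN conjunct2, rule_format, OF \<open>A \<in> sets borel\<close> S]
      finally show "(\<integral>\<^sup>+y\<in>S. emeasure (\<kappa> y) A \<partial>distr M borel Y) = (\<integral>\<^sup>+y\<in>S. emeasure (\<kappa>' y) A \<partial>distr M borel Y)" .
    qed measurable
  qed
  then show ?thesis
  proof eventually_elim
    case (elim y)
    show ?case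
      by (rule measure_eqI_generator_eq_countable[where E = E and \<Omega> = UNIV and A = "{UNIV}"])
         (use elim stable sets sp UNIV in auto)
  qed
qed

text \<open>The set of disagreement is open and Lebesgue null, hence empty.\<close>

lemma continuous_AE_lborel_eq:
  fixes f g :: "'a::euclidean_space \<Rightarrow> 'b::t2_space"
  assumes "continuous_on UNIV f" "continuous_on UNIV g" "AE x in lborel. f x = g x"
  shows "f = g"
proof -
  have op: "open {x. f x \<noteq> g x}" using assms(1,2) by (rule open_Collect_neq)
  obtain N where N: "N \<in> null_sets lborel" "{x. f x \<noteq> g x} \<subseteq> N"
    using assms(3) by (auto elim!: AE_E simp: null_sets_def)
  then have "negligible N" by (simp add: negligible_iff_null_sets null_sets_completionI)
  then have "negligible {x. f x \<noteq> g x}" using N(2) negligible_subset by blast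
  then show ?thesis using op open_not_negligible by fastforce
qed

section \<open>The linear Gaussian observation model\<close>

lemma mean_affine_std_normal_vec:
  fixes a :: "real^'m" and L :: "real^'n^'m"
  shows "integrable (distr std_normal_vec borel (\<lambda>w. a + L *v w)) (\<lambda>x. x)"
    and "(\<integral>x. x \<partial>distr std_normal_vec borel (\<lambda>w. a + L *v w)) = a"
proof -
  interpret prob_space "std_normal_vec :: (real^'n) measure" by (rule prob_space_std_normal_vec)
  have i: "integrable std_normal_vec (\<lambda>w. L *v w)"
    using integrable_std_normal_vec by (rule integrable_bounded_linear[OF matrix_vector_mul_bounded_linear])
  then show "integrable (distr std_normal_vec borel (\<lambda>w. a + L *v w)) (\<lambda>x. x)"
    by (subst integrable_distr_eq) simp_all
  have "(\<integral>w. L *v w \<partial>std_normal_vec) = 0"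
    by (simp add: integral_bounded_linear[OF matrix_vector_mul_bounded_linear integrable_std_normal_vec]
        integral_std_normal_vec)
  with i show "(\<integral>x. x \<partial>distr std_normal_vec borel (\<lambda>w. a + L *v w)) = a"
    by (simp add: integral_distr prob_space[simplified])
qed

text \<open>Preimages under \<open>f\<close> and \<open>g\<close> lie in the two independent
  sigma-algebras, so the joint law factorizes on rectangles, which determine the product
  measure.\<close>

lemma distr_pair_indep_set:
  fixes f :: "'a \<Rightarrow> 'b" and g :: "'a \<Rightarrow> 'c"
  assumes "prob_space M" and [measurable]: "f \<in> M \<rightarrow>\<^sub>M S" "g \<in> M \<rightarrow>\<^sub>M T"
    and indep: "prob_space.indep_set M (sets (vimage_algebra (space M) f S)) (sets (vimage_algebra (space M) g T))"
  shows "distr M S f \<Otimes>\<^sub>M distr M T g = distr M (S \<Otimes>\<^sub>M T) (\<lambda>x. (f x, g x))"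
proof (rule pair_measure_eqI)
  interpret M: prob_space M by fact
  interpret F: prob_space "distr M S f" by (rule M.prob_space_distr) measurable
  interpret G: prob_space "distr M T g" by (rule M.prob_space_distr) measurable
  show "sigma_finite_measure (distr M S f)" "sigma_finite_measure (distr M T g)" by unfold_locales
  show "sets (distr M S f \<Otimes>\<^sub>M distr M T g) = sets (distr M (S \<Otimes>\<^sub>M T) (\<lambda>x. (f x, g x)))"
    by (simp cong: sets_pair_measure_cong)
  fix A B assume "A \<in> sets (distr M S f)" "B \<in> sets (distr M T g)"
  then have [measurable]: "A \<in> sets S" "B \<in> sets T" by simp_all
  have "M.prob ((f -` A \<inter> space M) \<inter> (g -` B \<inter> space M)) = M.prob (f -` A \<inter> space M) * M.prob (g -` B \<inter> space M)"
    by (rule M.indep_setD[OF indep]) (auto intro: in_vimage_algebra)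
  moreover have "(\<lambda>x. (f x, g x)) -` (A \<times> B) \<inter> space M = (f -` A \<inter> space M) \<inter> (g -` B \<inter> space M)" by auto
  ultimately show "emeasure (distr M S f) A * emeasure (distr M T g) B = emeasure (distr M (S \<Otimes>\<^sub>M T) (\<lambda>x. (f x, g x))) (A \<times> B)"
    by (simp add: emeasure_distr M.emeasure_eq_measure ennreal_mult'[symmetric])
qed

text \<open>Independence lets the pair \<open>(f, \<epsilon>)\<close> be replaced by images of two
  independent standard normal vectors, to which \<open>gaussian_disintegration\<close> applies with
  \<open>B = H ** L1\<close> and \<open>c = H *v m\<close>.\<close>

lemma linear_gaussian_cond_distribution:
  fixes L1 :: "real^'n^'n" and L2 U :: "real^'p^'p" and H :: "real^'n^'p" and m :: "real^'n"
    and f :: "'a \<Rightarrow> real^'n" and \<epsilon> Y :: "'a \<Rightarrow> real^'p"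
  assumes "prob_space M" and fe [measurable]: "f \<in> borel_measurable M" "\<epsilon> \<in> borel_measurable M"
    and indep: "prob_space.indep_set M (sets (vimage_algebra (space M) f borel))
                                       (sets (vimage_algebra (space M) \<epsilon> borel))"
    and f: "distr M borel f = distr std_normal_vec borel (\<lambda>z. m + L1 *v z)"
    and \<epsilon>: "distr M borel \<epsilon> = distr std_normal_vec borel (\<lambda>z. L2 *v z)"
    and Y: "\<And>\<omega>. \<omega> \<in> space M \<Longrightarrow> Y \<omega> = H *v f \<omega> + \<epsilon> \<omega>"
    and U: "L2 ** U = mat 1"
  obtains k :: "real^'p \<Rightarrow> real" and V :: "real^'n^'n" and G :: "real^'p^'n"
  where "k \<in> borel_measurable borel" "\<And>y. 0 < k y"
    "\<And>e. G *v e = transpose (U ** (H ** L1)) *v (e - (U ** (H ** L1)) *v (G *v e))"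
    "distr M borel Y = density lborel k"
    "cond_distribution M f Y (\<lambda>y. distr std_normal_vec borel (\<lambda>w. m + L1 *v (G *v (U *v (y - H *v m))) + (L1 ** V) *v w))"
proof -
  interpret M: prob_space M by fact
  interpret std: prob_space "std_normal_vec :: (real^'n) measure" by (rule prob_space_std_normal_vec)
  interpret stdp: prob_space "std_normal_vec :: (real^'p) measure" by (rule prob_space_std_normal_vec)
  have [measurable]: "Y \<in> borel_measurable M"
    by (subst measurable_cong[OF Y]) auto
  obtain k :: "real^'p \<Rightarrow> real" and V :: "real^'n^'n" and G :: "real^'p^'n"
    where km [measurable]: "k \<in> borel_measurable borel" and k: "\<And>y. 0 < k y"
      and G: "\<And>e. G *v e = transpose (U ** (H ** L1)) *v (e - (U ** (H ** L1)) *v (G *v e))"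
      and dis: "\<And>S T. S \<in> sets borel \<Longrightarrow> T \<in> sets borel \<Longrightarrow>
      (\<integral>\<^sup>+z1. \<integral>\<^sup>+z2. indicator S (m + L1 *v z1) * indicator T (H *v m + (H ** L1) *v z1 + L2 *v z2) \<partial>std_normal_vec \<partial>std_normal_vec)
      = (\<integral>\<^sup>+y. ennreal (k y) * (emeasure (distr std_normal_vec borel (\<lambda>w. m + L1 *v (G *v (U *v (y - H *v m))) + (L1 ** V) *v w)) S
            * indicator T y) \<partial>lborel)"
    by (rule gaussian_disintegration[OF U, where m = m and c = "H *v m" and B = "H ** L1"]) (rule that; assumption)
  define \<kappa> where "\<kappa> y = distr std_normal_vec borel (\<lambda>w. m + L1 *v (G *v (U *v (y - H *v m))) + (L1 ** V) *v w)" for y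
  have prob: "prob_space (\<kappa> y)" for y
    unfolding \<kappa>_def by (rule std.prob_space_distr) measurable
  have joint: "emeasure M {\<omega> \<in> space M. f \<omega> \<in> S \<and> Y \<omega> \<in> T}
      = (\<integral>\<^sup>+y. ennreal (k y) * (emeasure (\<kappa> y) S * indicator T y) \<partial>lborel)"
    if [measurable]: "S \<in> sets borel" "T \<in> sets borel" for S T
  proof -
    interpret E: prob_space "distr M borel \<epsilon>" by (rule M.prob_space_distr) measurable
    \<comment> \<open>\<open>?D\<close> is the event \<open>f \<in> S\<close>,
      \<open>Y \<in> T\<close> in terms of the pair \<open>(f, \<epsilon>)\<close>.\<close>
    let ?D = "{x \<in> space (borel \<Otimes>\<^sub>M borel). fst x \<in> S \<and> H *v fst x + snd x \<in> T}"
    have D: "?D \<in> sets (borel \<Otimes>\<^sub>M borel)" by measurable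
    have "emeasure M {\<omega> \<in> space M. f \<omega> \<in> S \<and> Y \<omega> \<in> T}
        = emeasure (distr M (borel \<Otimes>\<^sub>M borel) (\<lambda>x. (f x, \<epsilon> x))) ?D"
      by (subst emeasure_distr[OF _ D]) (auto intro!: arg_cong[where f = "emeasure M"] simp: Y space_pair_measure)
    also have "\<dots> = emeasure (distr M borel f \<Otimes>\<^sub>M distr M borel \<epsilon>) ?D"
      by (simp add: distr_pair_indep_set[OF assms(1) fe indep])
    also have "\<dots> = (\<integral>\<^sup>+x. emeasure (distr M borel \<epsilon>) (Pair x -` ?D) \<partial>distr M borel f)"
      by (rule E.emeasure_pair_measure_alt) (use D in \<open>simp cong: sets_pair_measure_cong\<close>)
    also have "\<dots> = (\<integral>\<^sup>+x. \<integral>\<^sup>+e. indicator S x * indicator T (H *v x + e) \<partial>distr M borel \<epsilon> \<partial>distr M borel f)"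
    proof (rule nn_integral_cong)
      fix x :: "real^'n"
      have "Pair x -` ?D \<in> sets (distr M borel \<epsilon>)" using sets_Pair1[OF D] by simp
      then have "emeasure (distr M borel \<epsilon>) (Pair x -` ?D) = (\<integral>\<^sup>+e. indicator (Pair x -` ?D) e \<partial>distr M borel \<epsilon>)"
        by (rule nn_integral_indicator[symmetric])
      also have "\<dots> = (\<integral>\<^sup>+e. indicator S x * indicator T (H *v x + e) \<partial>distr M borel \<epsilon>)"
        by (intro nn_integral_cong) (auto simp: space_pair_measure split: split_indicator)
      finally show "emeasure (distr M borel \<epsilon>) (Pair x -` ?D) = \<dots>" .
    qed
    also have "\<dots> = (\<integral>\<^sup>+z1. \<integral>\<^sup>+z2. indicator S (m + L1 *v z1) * indicator T (H *v (m + L1 *v z1) + L2 *v z2) \<partial>std_normal_vec \<partial>std_normal_vec)"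
      unfolding f \<epsilon> by (simp add: nn_integral_distr)
    also have "\<dots> = (\<integral>\<^sup>+y. ennreal (k y) * (emeasure (\<kappa> y) S * indicator T y) \<partial>lborel)"
      unfolding \<kappa>_def dis[OF that, symmetric]
      by (simp add: matrix_vector_right_distrib matrix_vector_mul_assoc)
    finally show ?thesis .
  qed
  \<comment> \<open>Taking \<open>S = UNIV\<close> in \<open>joint\<close> leaves the marginal law
    of \<open>Y\<close>, since each \<open>\<kappa> y\<close> has mass 1.\<close>
  have law: "distr M borel Y = density lborel k"
  proof (rule measure_eqI)
    fix T assume "T \<in> sets (distr M borel Y)"
    then have [measurable]: "T \<in> sets borel" by simp
    have "emeasure (\<kappa> y) UNIV = 1" for y
      using prob_space.emeasure_space_1[OF prob[of y]] by (simp add: \<kappa>_def)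
    then show "emeasure (distr M borel Y) T = emeasure (density lborel k) T"
      using joint[of UNIV T] by (simp add: emeasure_distr emeasure_density vimage_def Int_def conj_commute)
  qed simp
  have meas: "\<kappa> \<in> borel \<rightarrow>\<^sub>M prob_algebra borel"
    unfolding \<kappa>_def[abs_def]
  proof (rule measurable_distr_prob_space2[where M = borel])
    show "(\<lambda>y. std_normal_vec) \<in> borel \<rightarrow>\<^sub>M prob_algebra (borel :: (real^'n) measure)"
      by (rule measurable_const) (simp add: space_prob_algebra std.prob_space_axioms)
    show "(\<lambda>(y, w). m + L1 *v (G *v (U *v (y - H *v m))) + (L1 ** V) *v w) \<in> borel \<Otimes>\<^sub>M borel \<rightarrow>\<^sub>M borel"
      by measurable
  qed
  then have [measurable]: "\<kappa> \<in> borel \<rightarrow>\<^sub>M subprob_algebra borel" by (rule measurable_prob_algebraD)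
  have "cond_distribution M f Y \<kappa>"
    unfolding cond_distribution_def
    by (auto simp: meas law nn_integral_density joint)
  then show thesis unfolding \<kappa>_def by (rule that[OF km k G law])
qed

section \<open>Minimization over the RKHS\<close>

text \<open>The transpose also satisfies the Penrose equations of a symmetric \<open>K\<close>, with
  the two projectors exchanged, so uniqueness applies.\<close>

lemma transpose_pinv:
  assumes "transpose K = K"
  shows "transpose (pinv K) = pinv (K :: real^'n^'n)"
proof (rule is_pinv_unique[where A = K])
  have p: "K ** pinv K ** K = K" "pinv K ** K ** pinv K = pinv K"
    "transpose (K ** pinv K) = K ** pinv K" "transpose (pinv K ** K) = pinv K ** K"
    using is_pinv_pinv[of K] by (auto simp: is_pinv_def)
  have 1: "K ** transpose (pinv K) = pinv K ** K" "transpose (pinv K) ** K = K ** pinv K"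
    using p(3,4) by (simp_all add: matrix_transpose_mul assms)
  have "K ** transpose (pinv K) ** K = K" "transpose (pinv K) ** K ** transpose (pinv K) = transpose (pinv K)"
    using arg_cong[OF p(1), of transpose] arg_cong[OF p(2), of transpose]
    by (simp_all add: matrix_transpose_mul assms matrix_mul_assoc)
  then show "is_pinv K (transpose (pinv K))"
    unfolding is_pinv_def by (simp add: 1 p(3,4))
qed (rule is_pinv_pinv)

text \<open>By \<open>K ** pinv K ** K = K\<close> the pseudoinverse disappears on the range. For
  \<open>u = K *v a\<close> the value is \<open>u \<bullet> b\<close>, which is the reproducing
  property.\<close>

lemma rkhs_inner_mult:
  assumes "transpose K = K"
  shows "rkhs_inner K (K *v a) (K *v b) = a \<bullet> (K *v b)"
proof -
  have "K ** pinv K ** K = K" using is_pinv_pinv[of K] by (simp add: is_pinv_def)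
  then have "K *v (pinv K *v (K *v b)) = K *v b" by (simp add: matrix_vector_mul_assoc matrix_mul_assoc)
  then show ?thesis
    unfolding rkhs_inner_def using inner_transpose_mult[of K a "pinv K *v (K *v b)"] assms by simp
qed

lemma subspace_rkhs_space: "subspace (rkhs_space K)"
  unfolding rkhs_space_def by (rule linear_subspace_image) (auto simp: subspace_UNIV)

lemma rkhs_inner_commute:
  assumes "transpose K = K"
  shows "rkhs_inner K u v = rkhs_inner K v u"
  unfolding rkhs_inner_def
  using inner_transpose_mult[of "pinv K" u v] by (simp add: transpose_pinv assms inner_commute)

lemma rkhs_inner_add_left: "rkhs_inner K (u + v) w = rkhs_inner K u w + rkhs_inner K v w"
  by (simp add: rkhs_inner_def inner_add_left)

lemma rkhs_inner_add_right: "rkhs_inner K w (u + v) = rkhs_inner K w u + rkhs_inner K w v"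
  by (simp add: rkhs_inner_def inner_add_right matrix_vector_right_distrib)

text \<open>With \<open>u = K *v a\<close> and \<open>b = transpose L *v a\<close>, the squared RKHS
  norm of \<open>u = L *v b\<close> is \<open>b \<bullet> b\<close>. It is nonnegative, and its
  vanishing forces \<open>b = 0\<close>, hence \<open>u = 0\<close>.\<close>

lemma inner_product_on_rkhs:
  fixes K L :: "real^'n^'n"
  assumes K: "K = L ** transpose L"
  shows "inner_product_on (rkhs_space K) (rkhs_inner K)"
proof -
  have sym: "transpose K = K" by (simp add: K matrix_transpose_mul)
  have "0 \<le> rkhs_inner K u u \<and> (rkhs_inner K u u = 0 \<longleftrightarrow> u = 0)" if uS: "u \<in> rkhs_space K" for u
  proof -
    obtain a where a: "u = K *v a" using uS by (auto simp: rkhs_space_def)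
    define b where "b = transpose L *v a"
    have u: "u = L *v b" by (simp add: a b_def K matrix_vector_mul_assoc del: transpose_matrix_vector)
    have "rkhs_inner K u u = a \<bullet> (L *v b)" using rkhs_inner_mult[OF sym, of a a] a u by simp
    also have "\<dots> = b \<bullet> b" using inner_transpose_mult[of L a b] by (simp add: b_def)
    finally have e: "rkhs_inner K u u = b \<bullet> b" .
    have "u = 0 \<Longrightarrow> rkhs_inner K u u = 0" by (simp add: rkhs_inner_def)
    then show ?thesis using e u by auto
  qed
  moreover have "rkhs_inner K u (a *\<^sub>R v + b *\<^sub>R w) = a * rkhs_inner K u v + b * rkhs_inner K u w" for u v w a b
    by (simp add: rkhs_inner_def inner_add_right matrix_vector_right_distrib matrix_vector_mult_scaleR)
  ultimately show ?thesis
    unfolding inner_product_on_def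
    using subspace_rkhs_space rkhs_inner_commute[OF sym] by blast
qed

text \<open>Common form of both objectives, in the centered variable \<open>x = g - m\<close> and
  with \<open>W\<close> in the role of \<open>matrix_inv R\<close>.\<close>

definition penalized_loss :: "real^'n^'n \<Rightarrow> real^'n^'p \<Rightarrow> real^'p^'p \<Rightarrow> real^'p \<Rightarrow> real^'n \<Rightarrow> real" where
  "penalized_loss K H W d x = (d - H *v x) \<bullet> (W *v (d - H *v x)) + rkhs_inner K x x"

text \<open>Symmetry of the weight merges the two cross terms of the expanded square into the linear
  term of \<open>post_objective\<close>.\<close>

lemma post_objective_eq:
  assumes W: "transpose (matrix_inv R) = matrix_inv R"
  shows "post_objective K H R d x = penalized_loss K H (matrix_inv R) d x / 2"
proof -
  have 1: "x \<bullet> ((pinv K + transpose H ** matrix_inv R ** H) *v x)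
      = rkhs_inner K x x + (H *v x) \<bullet> (matrix_inv R *v (H *v x))"
    using inner_transpose_mult[of H "matrix_inv R *v (H *v x)" x]
    by (simp add: matrix_vector_mult_add_rdistrib inner_add_right rkhs_inner_def
        matrix_vector_mul_assoc[symmetric] inner_commute)
  have 2: "((transpose H ** matrix_inv R) *v d) \<bullet> x = (matrix_inv R *v d) \<bullet> (H *v x)"
    using inner_transpose_mult[of H "matrix_inv R *v d" x]
    by (simp add: matrix_vector_mul_assoc[symmetric])
  have 3: "d \<bullet> (matrix_inv R *v (H *v x)) = (matrix_inv R *v d) \<bullet> (H *v x)"
    using inner_transpose_mult[of "matrix_inv R" d "H *v x"] W by simp
  show ?thesis
    unfolding post_objective_def penalized_loss_def 1 2
    by (simp add: matrix_vector_mult_diff_distrib inner_diff_left inner_diff_right 3 inner_commute[of "H *v x"])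
qed

text \<open>Squaring undoes the square roots in the norms because both quadratic forms are
  nonnegative, the RKHS one on \<open>rkhs_space K\<close>.\<close>

lemma rkhs_regression_objective_eq:
  fixes L :: "real^'n^'n"
  assumes "K = L ** transpose L" and "\<And>v. 0 \<le> v \<bullet> (matrix_inv R *v v)" and x: "x \<in> rkhs_space K"
  shows "rkhs_regression_objective K m H R y (m + x) = penalized_loss K H (matrix_inv R) (y - H *v m) x"
proof -
  have "0 \<le> rkhs_inner K x x"
    using inner_product_on_rkhs[OF assms(1)] x by (simp add: inner_product_on_def)
  then show ?thesis
    using assms(2)
    by (simp add: rkhs_regression_objective_def penalized_loss_def weighted_norm_def rkhs_norm_def
        matrix_vector_right_distrib diff_diff_eq)
qed

text \<open>Expansion around \<open>xs\<close>: its fixed-point equation cancels the terms linear in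
  \<open>u = x - xs\<close>, and the remaining quadratic part is at least
  \<open>rkhs_inner K u u\<close>, which is positive.\<close>

lemma penalized_loss_less:
  fixes L :: "real^'n^'n"
  assumes K: "K = L ** transpose L" and W: "transpose W = W" "\<And>v. 0 \<le> v \<bullet> (W *v v)"
    and xs: "xs = K *v (transpose H *v (W *v (d - H *v xs)))"
    and x: "x \<in> rkhs_space K" "x \<noteq> xs"
  shows "penalized_loss K H W d xs < penalized_loss K H W d x"
proof -
  have sym: "transpose K = K" by (simp add: K matrix_transpose_mul)
  define r where "r = d - H *v xs"
  define u where "u = x - xs"
  have xsS: "xs \<in> rkhs_space K" using xs by (metis rangeI rkhs_space_def)
  then have uS: "u \<in> rkhs_space K" unfolding u_def using x(1) subspace_rkhs_space subspace_diff by blast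
  then obtain a where a: "u = K *v a" by (auto simp: rkhs_space_def)
  have x_eq: "x = xs + u" by (simp add: u_def)
  have "rkhs_inner K u xs = rkhs_inner K (K *v a) (K *v (transpose H *v (W *v r)))"
    using xs a r_def by simp
  also have "\<dots> = u \<bullet> (transpose H *v (W *v r))"
    using inner_transpose_mult[of K a "transpose H *v (W *v r)"] sym rkhs_inner_mult[OF sym] a by simp
  also have "\<dots> = (H *v u) \<bullet> (W *v r)"
    using inner_transpose_mult[of H "W *v r" u] by (simp add: inner_commute)
  finally have cross: "rkhs_inner K u xs = (H *v u) \<bullet> (W *v r)" .
  have cross': "r \<bullet> (W *v (H *v u)) = (H *v u) \<bullet> (W *v r)"
    using inner_transpose_mult[of W r "H *v u"] W(1) by (simp add: inner_commute)
  have pos: "0 < rkhs_inner K u u"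
    using inner_product_on_rkhs[OF K] uS x(2) by (force simp: inner_product_on_def u_def less_le)
  have res: "d - H *v (xs + u) = r - H *v u" by (simp add: r_def matrix_vector_right_distrib)
  have "penalized_loss K H W d x = penalized_loss K H W d xs + (H *v u) \<bullet> (W *v (H *v u)) + rkhs_inner K u u"
    unfolding x_eq penalized_loss_def res r_def[symmetric]
    by (simp add: rkhs_inner_add_left rkhs_inner_add_right rkhs_inner_commute[OF sym, of xs u] cross
        matrix_vector_mult_diff_distrib inner_diff_left inner_diff_right cross')
  then show ?thesis using pos W(2)[of "H *v u"] by simp
qed

lemma is_arg_min_unique_set:
  fixes F :: "'a \<Rightarrow> 'b::linorder"
  assumes "x0 \<in> S" "\<And>x. x \<in> S \<Longrightarrow> x \<noteq> x0 \<Longrightarrow> F x0 < F x"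
  shows "{x. is_arg_min F (\<lambda>x. x \<in> S) x} = {x0}"
  using assms by (force simp: is_arg_min_linorder less_le_not_le)

section \<open>Inverting the noise covariance\<close>

lemma matrix_inv_unique:
  fixes A :: "real^'n^'n"
  assumes "A ** B = mat 1"
  shows "matrix_inv A = B"
proof -
  have "B ** A = mat 1" using assms matrix_left_right_inverse by blast
  then have "\<exists>X. A ** X = mat 1 \<and> X ** A = mat 1" using assms by blast
  then have "A ** matrix_inv A = mat 1 \<and> matrix_inv A ** A = mat 1"
    unfolding matrix_inv_def by (rule someI_ex)
  then show ?thesis
    using \<open>B ** A = mat 1\<close> by (metis matrix_mul_assoc matrix_mul_lid matrix_mul_rid)
qed

text \<open>A kernel vector of \<open>transpose L2\<close> is one of \<open>R\<close>, so
  definiteness makes the factor invertible. With inverse \<open>U\<close>, inverting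
  \<open>L2 ** transpose L2\<close> gives \<open>transpose U ** U\<close>.\<close>

lemma sym_pos_def_factor:
  fixes L2 :: "real^'p^'p"
  assumes "sym_pos_def R" "L2 ** transpose L2 = R"
  obtains U where "L2 ** U = mat 1" "matrix_inv R = transpose U ** U"
proof -
  have "inj ((*v) (transpose L2))"
  proof (subst linear_injective_0[OF matrix_vector_mul_linear], intro allI impI)
    fix x assume "transpose L2 *v x = 0"
    then have "R *v x = 0"
      by (simp add: assms(2)[symmetric] matrix_vector_mul_assoc[symmetric] del: transpose_matrix_vector)
    then show "x = 0" using assms(1) by (force simp: sym_pos_def_def)
  qed
  then obtain B where "B ** transpose L2 = mat 1" using matrix_left_invertible_injective by blast
  then have "transpose (B ** transpose L2) = mat 1" by (simp add: transpose_mat)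
  then have 1: "L2 ** transpose B = mat 1" by (simp add: matrix_transpose_mul)
  define U where "U = transpose B"
  have U: "L2 ** U = mat 1" "U ** L2 = mat 1" using 1 matrix_left_right_inverse by (auto simp: U_def)
  have "transpose L2 ** transpose U = mat 1"
    by (metis U(2) matrix_transpose_mul transpose_mat)
  then have "R ** (transpose U ** U) = mat 1"
    by (metis U(1) assms(2) matrix_mul_assoc matrix_mul_rid)
  then show thesis using U(1) matrix_inv_unique that by blast
qed

theorem theorem2:
  fixes M :: "'a measure"
    and K :: "real^'n^'n" and m :: "real^'n"
    and H :: "real^'n^'p" and R :: "real^'p^'p"
    and f :: "'a \<Rightarrow> real^'n" and \<epsilon> Y :: "'a \<Rightarrow> real^'p"
  assumes "prob_space M"
    and "sym_pos_semidef K" and "sym_pos_def R"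
    and "f \<in> M \<rightarrow>\<^sub>M borel" and "\<epsilon> \<in> M \<rightarrow>\<^sub>M borel"
    and "is_normal m K (distr M borel f)"
    and "is_normal 0 R (distr M borel \<epsilon>)"
    and "prob_space.indep_set M (sets (vimage_algebra (space M) f borel))
                                (sets (vimage_algebra (space M) \<epsilon> borel))"
    and "\<And>\<omega>. \<omega> \<in> space M \<Longrightarrow> Y \<omega> = H *v f \<omega> + \<epsilon> \<omega>"
  shows "inner_product_on (rkhs_space K) (rkhs_inner K) \<and>
    (\<exists>x_star m_post :: real^'p \<Rightarrow> real^'n.
       (\<forall>y. {x. is_arg_min (post_objective K H R (y - H *v m)) (\<lambda>x. x \<in> rkhs_space K) x}
            = {x_star y}) \<and>
       (\<forall>y. m_post y = m + x_star y) \<and>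
       (\<forall>\<mu>. is_gaussian_cond_mean M f Y \<mu> \<longleftrightarrow> \<mu> = m_post) \<and>
       (\<forall>y. {g. is_arg_min (rkhs_regression_objective K m H R y)
                           (\<lambda>g. g \<in> (+) m ` rkhs_space K) g}
            = {m_post y}))"
proof -
  interpret M: prob_space M by fact
  have [measurable]: "f \<in> borel_measurable M" "\<epsilon> \<in> borel_measurable M" by fact+
  have [measurable]: "Y \<in> borel_measurable M"
    by (subst measurable_cong[OF assms(9)]) auto
  \<comment> \<open>\<open>L1\<close> acts twice: it generates the law of \<open>f\<close> and,
    through \<open>K = L1 ** transpose L1\<close>, yields definiteness of the RKHS inner
    product.\<close>
  obtain L1 :: "real^'n^'n" where L1: "L1 ** transpose L1 = K" "distr M borel f = distr std_normal_vec borel (\<lambda>z. m + L1 *v z)"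
    using assms(6) unfolding is_normal_def by blast
  obtain L2 :: "real^'p^'p" where L2: "L2 ** transpose L2 = R" "distr M borel \<epsilon> = distr std_normal_vec borel (\<lambda>z. L2 *v z)"
    using assms(7) unfolding is_normal_def add_0 by blast
  obtain U where U: "L2 ** U = mat 1" "matrix_inv R = transpose U ** U"
    using sym_pos_def_factor[OF assms(3) L2(1)] by blast
  obtain k :: "real^'p \<Rightarrow> real" and V :: "real^'n^'n" and G :: "real^'p^'n"
    where [measurable]: "k \<in> borel_measurable borel" and k: "\<And>y. 0 < k y"
      and G: "\<And>e. G *v e = transpose (U ** (H ** L1)) *v (e - (U ** (H ** L1)) *v (G *v e))"
      and law: "distr M borel Y = density lborel k"
      and cond: "cond_distribution M f Y (\<lambda>y. distr std_normal_vec borel (\<lambda>w. m + L1 *v (G *v (U *v (y - H *v m))) + (L1 ** V) *v w))"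
        (is "cond_distribution M f Y ?\<kappa>")
    by (rule linear_gaussian_cond_distribution[OF assms(1,4,5,8) L1(2) L2(2) assms(9) U(1)]) (assumption, rule that)
  define x_star where "x_star y = L1 *v (G *v (U *v (y - H *v m)))" for y
  define m_post where "m_post y = m + x_star y" for y
  have W: "transpose (matrix_inv R) = matrix_inv R" "0 \<le> v \<bullet> (matrix_inv R *v v)" for v
    using inner_transpose_mult[of U "U *v v" v]
    by (simp_all add: U(2) matrix_transpose_mul matrix_vector_mul_assoc[symmetric] inner_commute
        del: transpose_matrix_vector)
  \<comment> \<open>Apply \<open>L1\<close> to the equation of \<open>G\<close>; the factors combine
    by \<open>L1 ** transpose L1 = K\<close> and
    \<open>transpose U ** U = matrix_inv R\<close>.\<close>
  have xs: "x_star y = K *v (transpose H *v (matrix_inv R *v ((y - H *v m) - H *v x_star y)))" for y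
  proof -
    have "x_star y = L1 *v (transpose (U ** (H ** L1)) *v (U *v (y - H *v m) - (U ** (H ** L1)) *v (G *v (U *v (y - H *v m)))))"
      unfolding x_star_def by (subst G) (rule refl)
    also have "(U ** (H ** L1)) *v (G *v (U *v (y - H *v m))) = U *v (H *v x_star y)"
      by (simp add: x_star_def matrix_vector_mul_assoc matrix_mul_assoc)
    finally show ?thesis
      by (simp add: U(2) L1(1)[symmetric] matrix_transpose_mul matrix_vector_mul_assoc[symmetric]
          matrix_vector_mult_diff_distrib del: transpose_matrix_vector)
  qed
  have xsS: "x_star y \<in> rkhs_space K" for y using xs by (metis rangeI rkhs_space_def)
  note less = penalized_loss_less[OF L1(1)[symmetric] W xs]
  have 1: "{x. is_arg_min (post_objective K H R (y - H *v m)) (\<lambda>x. x \<in> rkhs_space K) x} = {x_star y}" for y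
    by (rule is_arg_min_unique_set) (auto simp: xsS post_objective_eq[OF W(1)] less)
  have 2: "{g. is_arg_min (rkhs_regression_objective K m H R y) (\<lambda>g. g \<in> (+) m ` rkhs_space K) g} = {m_post y}" for y
    by (rule is_arg_min_unique_set)
       (auto simp: m_post_def xsS rkhs_regression_objective_eq[OF L1(1)[symmetric] W(2)] intro!: less)
  have mean: "integrable (?\<kappa> y) (\<lambda>x. x)" "(\<integral>x. x \<partial>?\<kappa> y) = m_post y" for y
    using mean_affine_std_normal_vec[of "m_post y" "L1 ** V"]
    by (simp_all add: m_post_def x_star_def)
  have cont: "continuous_on UNIV m_post"
    unfolding m_post_def[abs_def] x_star_def
    by (intro continuous_intros bounded_linear.continuous_on[OF matrix_vector_mul_bounded_linear])
  have normal: "\<exists>a C. is_normal a C (?\<kappa> y)" for y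
    unfolding is_normal_def by blast
  have 3: "is_gaussian_cond_mean M f Y \<mu> \<longleftrightarrow> \<mu> = m_post" for \<mu>
  proof
    assume "is_gaussian_cond_mean M f Y \<mu>"
    then obtain \<kappa>' where \<kappa>': "cond_distribution M f Y \<kappa>'" "\<And>y. \<mu> y = (\<integral>x. x \<partial>\<kappa>' y)" "continuous_on UNIV \<mu>"
      unfolding is_gaussian_cond_mean_def by blast
    have "AE y in density lborel k. \<kappa>' y = ?\<kappa> y"
      unfolding law[symmetric]
      by (rule cond_distribution_AE_unique[OF assms(1) _ \<kappa>'(1) cond]) measurable
    then have "AE y in density lborel k. \<mu> y = m_post y"
      by eventually_elim (simp add: \<kappa>'(2) mean(2))
    \<comment> \<open>Positivity of \<open>k\<close> turns null sets of the law of \<open>Y\<close>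
      into Lebesgue null sets; continuity then gives equality at every \<open>y\<close>.\<close>
    then have "AE y in lborel. \<mu> y = m_post y"
      using k by (simp add: AE_density)
    then show "\<mu> = m_post" using continuous_AE_lborel_eq \<kappa>'(3) cont by blast
  next
    assume "\<mu> = m_post"
    then show "is_gaussian_cond_mean M f Y \<mu>"
      unfolding is_gaussian_cond_mean_def using cond normal mean cont by auto
  qed
  show ?thesis
    using inner_product_on_rkhs[OF L1(1)[symmetric]] 1 2 3 m_post_def by blast
qed

end
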